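(* Let $\Sigma$ be a two-letter alphabet, $\Gamma$ a finite alphabet with at least two letters, and let $w\in\Sigma^{\mathbb{N}}$ be an infinite word with $\mathrm{ACE}(w)\in\mathbb{R}$. If $w$ has uniform letter frequencies or $\mathrm{ACE}(w)\in\mathbb{N}$, then $\mathrm{ACE}_{\mathcal{I}}(w) = \mathrm{ACE}(w)$. Otherwise, $\mathrm{ACE}_{\mathcal{I}}(w) < \lceil\mathrm{ACE}(w)\rceil$.
   Context: An infinite word $w$ has uniform letter frequencies if for every letter $a$ occurring in $w$, $\liminf \frac{|f|_a}{|f|} = \limsup\frac{|f|_a}{|f|}$, where both are taken over factors $f$ of $w$ as $|f|\to\infty$ and $|f|_a$ is the number of occurrences of $a$ in $f$. $\mathrm{Fact}_n(w)$ is the set of length-$n$ factors of $w$. For a nonempty word $v$ and integer $p\ge0$, $v^{p/|v|}$ is the prefix of length $p$ of $vvv\cdots$. For a nonempty finite word $x$, $\mathrm{E}(x) = \sup\{ r \in \mathbb{Q} : x = v^r \text{ for some nonempty } v\}$. $\mathrm{ACE}(w) = \limsup_{n\to\infty}\sup\{\mathrm{E}(x) : x\in\mathrm{Fact}_n(w)\}$. $\mathcal{I}$ is the set of injective morphisms $\Sigma^*\to\Gamma^*$ and $\mathrm{ACE}_{\mathcal{I}}(w) = \sup\{\mathrm{ACE}(h(w)) : h\in\mathcal{I}\}$. *)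

theory Defs
  imports Complex_Main "HOL-Library.Extended_Real" "HOL-Library.Liminf_Limsup"
begin

definition Fact :: "nat \<Rightarrow> (nat \<Rightarrow> 'a) \<Rightarrow> 'a list set" where
  "Fact n w = {map w [i..<i+n] | i. True}"

definition pow_prefix :: "'a list \<Rightarrow> nat \<Rightarrow> 'a list" where
  "pow_prefix v p = map (\<lambda>i. v ! (i mod length v)) [0..<p]"

definition Exp :: "'a list \<Rightarrow> real" where
  "Exp x = Sup {r. r \<in> \<rat> \<and> (\<exists>v p. v \<noteq> [] \<and> r = real p / real (length v) \<and> x = pow_prefix v p)}"

definition ACE :: "(nat \<Rightarrow> 'a) \<Rightarrow> ereal" where
  "ACE w = limsup (\<lambda>n. SUP x \<in> Fact n w. ereal (Exp x))"

definition morph :: "('a \<Rightarrow> 'b list) \<Rightarrow> 'a list \<Rightarrow> 'b list" where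
  "morph f u = concat (map f u)"

definition injective_morph :: "('a \<Rightarrow> 'b list) \<Rightarrow> bool" where
  "injective_morph f \<longleftrightarrow> inj (morph f)"

text \<open>Image of an infinite word under a nonerasing morphism: the i-th letter of
  h(w) is the i-th letter of h(w_0 ... w_i) (which has length > i).\<close>
definition morph_inf :: "('a \<Rightarrow> 'b list) \<Rightarrow> (nat \<Rightarrow> 'a) \<Rightarrow> nat \<Rightarrow> 'b" where
  "morph_inf f w i = morph f (map w [0..<Suc i]) ! i"

definition ACE_I :: "'b itself \<Rightarrow> (nat \<Rightarrow> 'a) \<Rightarrow> ereal" where
  "ACE_I _ w = (SUP f \<in> {f :: 'a \<Rightarrow> 'b list. injective_morph f}. ACE (morph_inf f w))"

definition count_letter :: "'a \<Rightarrow> 'a list \<Rightarrow> nat" where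
  "count_letter a f = length (filter (\<lambda>b. b = a) f)"

definition uniform_freq :: "(nat \<Rightarrow> 'a) \<Rightarrow> bool" where
  "uniform_freq w \<longleftrightarrow> (\<forall>a \<in> range w.
     liminf (\<lambda>n. INF f \<in> Fact n w. ereal (real (count_letter a f) / real n)) =
     limsup (\<lambda>n. SUP f \<in> Fact n w. ereal (real (count_letter a f) / real n)))"

end

theory Submission
  imports Defs "HOL-Library.Sublist"
begin

text \<open>
  Let \<open>h\<close> be injective on two letters. Since \<open>h(a)\<close> and \<open>h(b)\<close> do not commute, there is a fixed
  \<open>l\<close> such that images of infinite words with different first letters agree on exactly \<open>l\<close> letters.
  If a text has two parses into blocks \<open>h(a)\<close>, \<open>h(b)\<close> without a common cut, this makes each
  parse determine the next block of the other one; by the pigeonhole principle the parses become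
  periodic, which a finite asymptotic critical exponent excludes for long factors of \<open>h(w)\<close>. Thus a long
  repetition in \<open>h(w)\<close> of period \<open>q\<close> comes, up to a bounded error, from a repetition
  \<open>u\<^sup>j u'\<close> in \<open>w\<close> with \<open>|h(u)| = q\<close>, and its exponent is about
  \<open>j + |h(u')| / |h(u)|\<close>. If the letters have uniform frequencies, this is asymptotically the
  exponent of \<open>u\<^sup>j u'\<close>. If \<open>ACE(w)\<close> is an integer, it is the upper bound: either \<open>j\<close> is smaller or
  \<open>u'\<close> is negligible. Otherwise both letters have positive density in
  \<open>w\<close>, so the part of \<open>u\<close> missing from \<open>u'\<close> has an image of length at
  least a fixed fraction of \<open>|h(u)|\<close>, whatever \<open>h\<close> is.
\<close>

section \<open>Periodic factors and the asymptotic critical exponent\<close>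

text \<open>The condition is vacuous for \<open>n \<le> q\<close>; the bounds on exponents therefore
  carry \<open>q \<le> n\<close> separately.\<close>

definition has_period_on :: "(nat \<Rightarrow> 'a) \<Rightarrow> nat \<Rightarrow> nat \<Rightarrow> nat \<Rightarrow> bool" where
  "has_period_on w i n q \<longleftrightarrow> (\<forall>t. t + q < n \<longrightarrow> w (i + t) = w (i + t + q))"

lemma length_pow_prefix [simp]: "length (pow_prefix v p) = p"
  by (simp add: pow_prefix_def)

lemma Exp_bdd_above:
  "bdd_above {r. r \<in> \<rat> \<and> (\<exists>v p. v \<noteq> [] \<and> r = real p / real (length v) \<and> x = pow_prefix v p)}"
proof (rule bdd_aboveI[where M = "real (length x)"])
  fix r assume "r \<in> {r. r \<in> \<rat> \<and> (\<exists>v p. v \<noteq> [] \<and> r = real p / real (length v) \<and> x = pow_prefix v p)}"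
  then obtain v p where "v \<noteq> []" "r = real p / real (length v)" "x = pow_prefix v p" by blast
  moreover from this have "length v \<ge> 1" by (cases v) auto
  ultimately show "r \<le> real (length x)"
    by (simp add: divide_le_eq mult_le_cancel_left1)
qed

lemma has_period_on_mod:
  assumes "has_period_on w i n q" "q \<ge> 1" "t < n"
  shows "w (i + t) = w (i + t mod q)"
  using assms(3)
proof (induction t rule: less_induct)
  case (less t)
  show ?case
  proof (cases "t < q")
    case False
    then have "w (i + (t - q)) = w (i + (t - q) + q)"
      using assms(1) less.prems unfolding has_period_on_def by (metis le_add_diff_inverse2 not_less)
    moreover have "w (i + (t - q)) = w (i + (t - q) mod q)"
      by (rule less.IH) (use less.prems False assms(2) in auto)
    moreover have "(t - q) mod q = t mod q" using False by (simp add: le_mod_geq)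
    ultimately show ?thesis using False by simp
  qed simp
qed

lemma Exp_ge:
  assumes "has_period_on w i n q" "1 \<le> q" "q \<le> n"
  shows "real n / real q \<le> Exp (map w [i..<i+n])"
  unfolding Exp_def
proof (rule cSup_upper[OF _ Exp_bdd_above], safe)
  show "real n / real q \<in> \<rat>" by simp
  have "map w [i..<i+n] = pow_prefix (map w [i..<i+q]) n"
    using has_period_on_mod[OF assms(1,2)] assms(2)
    by (intro nth_equalityI) (auto simp: pow_prefix_def)
  moreover have "map w [i..<i+q] \<noteq> []" using assms(2) by simp
  ultimately show "\<exists>v p. v \<noteq> [] \<and> real n / real q = real p / real (length v) \<and> map w [i..<i+n] = pow_prefix v p"
    by (intro exI[of _ "map w [i..<i+q]"] exI[of _ n]) simp
qed

text \<open>A root longer than the word gives an exponent below 1, which \<open>e \<ge> 1\<close>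
  absorbs, so only periods up to \<open>n\<close> have to be examined.\<close>

lemma Exp_le:
  assumes "e \<ge> 1" "\<And>q. 1 \<le> q \<Longrightarrow> q \<le> n \<Longrightarrow> has_period_on w i n q \<Longrightarrow> real n \<le> e * real q"
  shows "Exp (map w [i..<i+n]) \<le> e"
  unfolding Exp_def
proof (rule cSup_least)
  show "{r. r \<in> \<rat> \<and> (\<exists>v p. v \<noteq> [] \<and> r = real p / real (length v) \<and> map w [i..<i+n] = pow_prefix v p)} \<noteq> {}"
  proof (cases "n = 0")
    case True
    \<comment> \<open>The supremum needs a nonempty set; the empty word is the zeroth power of an
      arbitrary letter.\<close>
    then have "map w [i..<i+n] = pow_prefix [undefined] 0" by (simp add: pow_prefix_def)
    then have "\<exists>v p. v \<noteq> [] \<and> 0 = real p / real (length v) \<and> map w [i..<i+n] = pow_prefix v p"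
      by (intro exI[of _ "[undefined]"] exI[of _ 0]) simp
    then show ?thesis using Rats_0 by blast
  next
    case False
    have "map w [i..<i+n] = pow_prefix (map w [i..<i+n]) n"
      by (intro nth_equalityI) (auto simp: pow_prefix_def)
    then have "\<exists>v p. v \<noteq> [] \<and> 1 = real p / real (length v) \<and> map w [i..<i+n] = pow_prefix v p"
      using False by (intro exI[of _ "map w [i..<i+n]"] exI[of _ n]) simp
    then show ?thesis using Rats_1 by blast
  qed
  fix r assume "r \<in> {r. r \<in> \<rat> \<and> (\<exists>v p. v \<noteq> [] \<and> r = real p / real (length v) \<and> map w [i..<i+n] = pow_prefix v p)}"
  then obtain v p where v: "v \<noteq> []" "r = real p / real (length v)" "map w [i..<i+n] = pow_prefix v p"
    by blast
  have [simp]: "p = n" using v(3) by (metis length_map length_upt length_pow_prefix add_diff_cancel_left')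
  have q: "length v \<ge> 1" using v(1) by (cases v) auto
  have nth: "w (i + t) = v ! (t mod length v)" if "t < n" for t
    using arg_cong[OF v(3), of "\<lambda>x. x ! t"] that by (simp add: pow_prefix_def)
  have "has_period_on w i n (length v)"
    unfolding has_period_on_def
  proof (intro allI impI)
    fix t assume "t + length v < n"
    then show "w (i + t) = w (i + t + length v)"
      using nth[of t] nth[of "t + length v"] by (simp add: add.assoc)
  qed
  then have "real n \<le> e * real (length v)"
  proof (cases "length v \<le> n")
    case False
    have "real n \<le> 1 * real (length v)" using False by simp
    also have "\<dots> \<le> e * real (length v)" using assms(1) by (intro mult_right_mono) auto
    finally show ?thesis .
  qed (use assms(2) q in auto)
  then show "r \<le> e" using v(1,2) by (simp add: divide_le_eq)
qed

text \<open>Together with \<open>ACE_leI\<close> this replaces the limsup of suprema by inequalities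
  between lengths and periods, the form in which the critical exponent is used from here on.\<close>

lemma ACE_lessD:
  assumes "ACE w < ereal e"
  shows "\<exists>n0. \<forall>n\<ge>n0. \<forall>i q. 1 \<le> q \<longrightarrow> q \<le> n \<longrightarrow> has_period_on w i n q \<longrightarrow> real n \<le> e * real q"
proof -
  from Limsup_lessD[OF assms[unfolded ACE_def]]
  obtain n0 where n0: "\<And>n. n \<ge> n0 \<Longrightarrow> (SUP x\<in>Fact n w. ereal (Exp x)) < ereal e"
    by (auto simp: eventually_sequentially)
  show ?thesis
  proof (intro exI allI impI)
    fix n i q assume n: "n0 \<le> n" "1 \<le> q" "q \<le> n" "has_period_on w i n q"
    have "ereal (Exp (map w [i..<i+n])) \<le> (SUP x\<in>Fact n w. ereal (Exp x))"
      by (rule SUP_upper) (auto simp: Fact_def)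
    also have "\<dots> < ereal e" using n0 n(1) .
    finally have "real n / real q \<le> e" using Exp_ge[OF n(4,2,3)] by simp
    then show "real n \<le> e * real q" using n(2) by (simp add: divide_le_eq)
  qed
qed

lemma ACE_leI:
  assumes "e \<ge> 1"
    and "\<And>n i q. n \<ge> n0 \<Longrightarrow> 1 \<le> q \<Longrightarrow> q \<le> n \<Longrightarrow> has_period_on w i n q \<Longrightarrow> real n \<le> e * real q"
  shows "ACE w \<le> ereal e"
  unfolding ACE_def
proof (rule Limsup_bounded)
  show "\<forall>\<^sub>F n in sequentially. (SUP x\<in>Fact n w. ereal (Exp x)) \<le> ereal e"
    unfolding eventually_sequentially
    using assms by (intro exI[of _ n0]) (auto intro!: SUP_least Exp_le simp: Fact_def)
qed

lemma ACE_ge_1: "ACE w \<ge> 1"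
proof (rule ccontr)
  assume "\<not> ACE w \<ge> 1"
  then have "ACE w < 1" by simp
  then obtain e where e: "ACE w < ereal e" "ereal e < 1"
    using ereal_dense2 by blast
  from ACE_lessD[OF e(1)] obtain n0 where
    n0: "\<And>n i q. n \<ge> n0 \<Longrightarrow> 1 \<le> q \<Longrightarrow> q \<le> n \<Longrightarrow> has_period_on w i n q \<Longrightarrow> real n \<le> e * real q" by blast
  \<comment> \<open>A nonempty word has its own length as a period, so its exponent is at least
    1.\<close>
  have "real (Suc n0) \<le> e * real (Suc n0)" by (rule n0) (auto simp: has_period_on_def)
  then have "real (Suc n0) * (1 - e) \<le> 0" by (simp add: algebra_simps)
  then show False using e(2) by (simp add: mult_le_0_iff)
qed

text \<open>This is the form in which finiteness of the critical exponent enters the combinatorics: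
  \<open>K\<close> depends on \<open>N\<close> only, not on the place \<open>i\<close>.\<close>

definition bounded_periods :: "(nat \<Rightarrow> 'a) \<Rightarrow> bool" where
  "bounded_periods w \<longleftrightarrow>
     (\<forall>N. \<exists>K. \<forall>i n q. 1 \<le> q \<longrightarrow> q \<le> N \<longrightarrow> has_period_on w i n q \<longrightarrow> n < K)"

lemma bounded_periods_if_ACE_finite:
  assumes "ACE w \<noteq> \<infinity>"
  shows "bounded_periods w"
  unfolding bounded_periods_def
proof
  fix N
  obtain e where "ACE w < ereal e" using assms by (metis ereal_dense2 ereal_infty_less(1))
  from ACE_lessD[OF this] obtain n0 where
    n0: "\<And>n i q. n \<ge> n0 \<Longrightarrow> 1 \<le> q \<Longrightarrow> q \<le> n \<Longrightarrow> has_period_on w i n q \<Longrightarrow> real n \<le> e * real q" by blast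
  obtain B :: nat where B: "e < real B" using reals_Archimedean2 by blast
  show "\<exists>K. \<forall>i n q. 1 \<le> q \<longrightarrow> q \<le> N \<longrightarrow> has_period_on w i n q \<longrightarrow> n < K"
  proof (intro exI allI impI, rule ccontr)
    \<comment> \<open>The summands secure \<open>n0 \<le> n\<close>, \<open>q \<le> n\<close> and
      \<open>n > B * N\<close> in turn.\<close>
    fix i n q assume q: "1 \<le> q" "q \<le> N" "has_period_on w i n q" and "\<not> n < n0 + N + B * N + 1"
    then have n: "n \<ge> n0" "q \<le> n" "n > B * N" by auto
    have "real n \<le> e * real q" using n0 n q by blast
    also have "\<dots> \<le> real B * real N" using B q by (intro mult_mono) auto
    finally have "n \<le> B * N" by (simp flip: of_nat_mult)
    then show False using n by simp
  qed
qed

section \<open>Images under two-word codes\<close>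

text \<open>Finite products stand in for infinite ones: whatever the continuations are, the common
  prefix has length exactly \<open>l\<close>. The length conditions only make position
  \<open>l\<close> exist.\<close>

definition diverge_at :: "'b list \<Rightarrow> 'b list \<Rightarrow> nat \<Rightarrow> bool" where
  "diverge_at x y l \<longleftrightarrow> (\<forall>us\<in>lists {x, y}. \<forall>vs\<in>lists {x, y}.
     l < length (concat (x # us)) \<longrightarrow> l < length (concat (y # vs)) \<longrightarrow>
     take l (concat (x # us)) = take l (concat (y # vs)) \<and>
     concat (x # us) ! l \<noteq> concat (y # vs) ! l)"

lemma diverge_at_sym:
  assumes "diverge_at x y l"
  shows "diverge_at y x l"
  unfolding diverge_at_def insert_commute[of y x "{}"]
proof (intro ballI impI)
  fix us vs assume "us \<in> lists {x, y}" "vs \<in> lists {x, y}"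
    "l < length (concat (y # us))" "l < length (concat (x # vs))"
  with assms have "take l (concat (x # vs)) = take l (concat (y # us)) \<and>
      concat (x # vs) ! l \<noteq> concat (y # us) ! l"
    unfolding diverge_at_def by blast
  then show "take l (concat (y # us)) = take l (concat (x # vs)) \<and>
      concat (y # us) ! l \<noteq> concat (x # vs) ! l" by metis
qed

text \<open>A nonempty product of \<open>x\<close> and \<open>x @ y\<close> is a product of
  \<open>x\<close> and \<open>y\<close> that starts with \<open>x\<close>. Removing the leading
  \<open>x\<close> on both sides leaves products starting with \<open>x\<close> and with
  \<open>y\<close>, to which the assumption applies.\<close>

lemma diverge_at_euclid:
  assumes l: "diverge_at x y l"
  shows "diverge_at x (x @ y) (length x + l)"
  unfolding diverge_at_def
proof (intro ballI impI)
  have re: "\<exists>us'\<in>lists {x, y}. concat us' = concat us \<and> (us \<noteq> [] \<longrightarrow> us' \<noteq> [] \<and> hd us' = x)"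
    if "us \<in> lists {x, x @ y}" for us
    using that
  proof (induction us)
    case (Cons u us)
    then obtain us' where us': "us' \<in> lists {x, y}" "concat us' = concat us" by blast
    show ?case
    proof (cases "u = x")
      case True
      then show ?thesis using us' by (intro bexI[of _ "x # us'"]) auto
    next
      case False
      then have "u = x @ y" using Cons.hyps by simp
      then show ?thesis using us' by (intro bexI[of _ "x # y # us'"]) auto
    qed
  qed (auto intro: bexI[of _ "[]"])
  fix us vs assume us: "us \<in> lists {x, x @ y}" and vs: "vs \<in> lists {x, x @ y}"
    and l1: "length x + l < length (concat (x # us))"
    and l2: "length x + l < length (concat ((x @ y) # vs))"
  \<comment> \<open>The word \<open>x\<close> alone would be too short to have a letter at position
    \<open>length x + l\<close>.\<close>
  have "us \<noteq> []" using l1 by auto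
  then obtain us1 where us1: "us1 \<in> lists {x, y}" "concat us1 = concat us" "us1 \<noteq> []" "hd us1 = x"
    using re[OF us] by blast
  define us' where "us' = tl us1"
  have us': "us' \<in> lists {x, y}" "concat us = concat (x # us')"
    using us1 by (cases us1; simp add: us'_def)+
  obtain vs' where vs': "vs' \<in> lists {x, y}" "concat vs' = concat vs"
    using re[OF vs] by blast
  have "concat (x # us) = x @ concat (x # us')" "concat ((x @ y) # vs) = x @ concat (y # vs')"
    using us' vs' by auto
  moreover have "take l (concat (x # us')) = take l (concat (y # vs')) \<and>
      concat (x # us') ! l \<noteq> concat (y # vs') ! l"
    using l[unfolded diverge_at_def, rule_format, OF us'(1) vs'(1)] l1 l2 us' vs' by simp
  ultimately show "take (length x + l) (concat (x # us)) = take (length x + l) (concat ((x @ y) # vs)) \<and>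
      concat (x # us) ! (length x + l) \<noteq> concat ((x @ y) # vs) ! (length x + l)"
    by (simp add: nth_append del: concat.simps)
qed

text \<open>Euclid's algorithm: while one word is a prefix of the other, that prefix is split off,
  and \<open>diverge_at_euclid\<close> carries the result back. Noncommutation survives and keeps
  both words nonempty, so the total length drops until the words differ at a position inside
  both.\<close>

lemma ex_diverge_at: "x @ y \<noteq> y @ x \<Longrightarrow> \<exists>l. diverge_at x y l"
proof (induction "length x + length y" arbitrary: x y rule: less_induct)
  case less
  have ne: "x \<noteq> []" "y \<noteq> []" using less.prems by auto
  consider y' where "y = x @ y'" | x' where "x = y @ x'"
    | "\<not> (\<exists>y'. y = x @ y')" "\<not> (\<exists>x'. x = y @ x')" by blast
  then show ?case
  proof cases
    case 1
    then have "x @ y' \<noteq> y' @ x" "length x + length y' < length x + length y"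
      using less.prems ne by auto
    then show ?thesis using less.hyps diverge_at_euclid 1 by blast
  next
    case 2
    then have "y @ x' \<noteq> x' @ y" "length y + length x' < length x + length y"
      using less.prems ne by auto
    then show ?thesis using less.hyps diverge_at_euclid diverge_at_sym 2 by blast
  next
    case 3
    then have "x \<parallel> y" by (auto simp: prefix_def)
    then obtain p a x' b y' where "x = p @ a # x'" "y = p @ b # y'" "a \<noteq> b"
      using parallel_decomp by metis
    then have "diverge_at x y (length p)" by (simp add: diverge_at_def)
    then show ?thesis ..
  qed
qed

lemma morph_append: "morph f (u @ v) = morph f u @ morph f v"
  by (simp add: morph_def)

lemma length_morph_eq_sum:
  fixes u :: "'a::finite list"
  shows "length (morph f u) = (\<Sum>a\<in>UNIV. length (f a) * count_letter a u)"
proof (induction u)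
  case (Cons b u)
  have "(\<Sum>a\<in>UNIV. length (f a) * count_letter a (b # u)) =
      (\<Sum>a\<in>UNIV. (if a = b then length (f a) else 0) + length (f a) * count_letter a u)"
    by (intro sum.cong) (auto simp: count_letter_def)
  also have "\<dots> = length (f b) + length (morph f u)"
    by (simp add: sum.distrib Cons.IH)
  finally show ?case by (simp add: morph_def)
qed (simp add: morph_def count_letter_def)

lemma upt_append: "i \<le> j \<Longrightarrow> j \<le> k \<Longrightarrow> [i..<k] = [i..<j] @ [j..<k]"
  by (metis le_Suc_ex upt_add_eq_append)

section \<open>Cuts of the parse of the image, and the delay of the code\<close>

locale two_letter_code =
  fixes w :: "nat \<Rightarrow> 'a::finite" and f :: "'a \<Rightarrow> 'b list"
  assumes two_letters: "card (UNIV :: 'a set) = 2" and inj_f: "injective_morph f"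
begin

abbreviation W :: "nat \<Rightarrow> 'b" where "W \<equiv> morph_inf f w"

definition cut :: "nat \<Rightarrow> nat" where "cut i = length (morph f (map w [0..<i]))"

text \<open>The sum bounds every block length from above; it also bounds images from below, since a
  factor containing each letter at least \<open>c\<close> times has an image of length at least
  \<open>M * c\<close>.\<close>

definition M :: nat where "M = (\<Sum>a\<in>UNIV. length (f a))"

lemma UNIV_eq: "a \<noteq> b \<Longrightarrow> (UNIV :: 'a set) = {a, b}"
  using two_letters by (intro card_seteq[symmetric]) auto

lemma f_not_commute: "a \<noteq> b \<Longrightarrow> f a @ f b \<noteq> f b @ f a"
proof
  assume "a \<noteq> b" "f a @ f b = f b @ f a"
  then have "morph f [a, b] = morph f [b, a]" by (simp add: morph_def)
  then have "[a, b] = [b, a]" using inj_f unfolding injective_morph_def by (rule injD[rotated])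
  then show False using \<open>a \<noteq> b\<close> by simp
qed

lemma f_nonempty: "f a \<noteq> []"
proof
  assume "f a = []"
  then have "morph f [a] = morph f []" by (simp add: morph_def)
  then have "[a] = []" using inj_f unfolding injective_morph_def by (rule injD[rotated])
  then show False by simp
qed

lemma length_f_pos: "1 \<le> length (f a)"
  using f_nonempty[of a] by (cases "f a") auto

lemma length_f_le: "length (f a) \<le> M"
  unfolding M_def by (rule member_le_sum) auto

lemma cut_0: "cut 0 = 0"
  by (simp add: cut_def morph_def)

lemma cut_add: "cut (i + n) = cut i + length (morph f (map w [i..<i+n]))"
  unfolding cut_def by (subst upt_append[of 0 i "i+n"]) (auto simp: morph_append)

lemma cut_Suc: "cut (Suc i) = cut i + length (f (w i))"
  using cut_add[of i 1] by (simp add: morph_def)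

lemma cut_add_ge: "cut i + n \<le> cut (i + n)"
  by (induction n) (use length_f_pos in \<open>auto simp: cut_Suc intro: order.trans add_mono\<close>)

lemma cut_add_le: "cut (i + n) \<le> cut i + M * n"
  by (induction n) (use length_f_le in \<open>auto simp: cut_Suc intro: order.trans add_mono\<close>)

lemma strict_mono_cut: "strict_mono cut"
  unfolding strict_mono_Suc_iff using length_f_pos by (simp add: cut_Suc Suc_le_eq)

text \<open>\<open>morph_inf\<close> reads letter \<open>p\<close> off the image of the prefix of
  length \<open>p + 1\<close>; any other prefix whose image covers \<open>p\<close> gives the same
  letter, because images of prefixes are nested.\<close>

lemma W_eq_nth: "p < cut i \<Longrightarrow> W p = morph f (map w [0..<i]) ! p"
proof -
  assume p: "p < cut i"
  have q: "p < cut (Suc p)" using cut_add_ge[of 0 "Suc p"] cut_0 by simp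
  have "morph f (map w [0..<j]) ! p = morph f (map w [0..<k]) ! p" if "p < cut j" "j \<le> k" for j k
    using that by (subst upt_append[of 0 j k]) (auto simp: morph_append cut_def nth_append)
  from this[OF p] this[OF q] show ?thesis
    unfolding morph_inf_def by (metis nat_le_linear)
qed

lemma W_cut_add:
  assumes "t < length (morph f (map w [i..<i+n]))"
  shows "W (cut i + t) = morph f (map w [i..<i+n]) ! t"
proof -
  have "W (cut i + t) = morph f (map w [0..<i+n]) ! (cut i + t)"
    by (rule W_eq_nth) (use assms in \<open>simp add: cut_add\<close>)
  also have "\<dots> = morph f (map w [i..<i+n]) ! t"
    by (subst upt_append[of 0 i "i+n"]) (auto simp: morph_append cut_def nth_append)
  finally show ?thesis .
qed

lemma W_block: "t < length (f (w i)) \<Longrightarrow> W (cut i + t) = f (w i) ! t"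
  using W_cut_add[of t i 1] by (simp add: morph_def)

lemma ex_divergence:
  "\<exists>l. \<forall>i j. w i \<noteq> w j \<longrightarrow>
     (\<forall>t<l. W (cut i + t) = W (cut j + t)) \<and> W (cut i + l) \<noteq> W (cut j + l)"
proof -
  obtain a b :: 'a where ab: "a \<noteq> b" using two_letters by (metis card_2_iff)
  obtain l where l: "diverge_at (f a) (f b) l" using ex_diverge_at[OF f_not_commute[OF ab]] by blast
  have main: "(\<forall>t<l. W (cut i + t) = W (cut j + t)) \<and> W (cut i + l) \<noteq> W (cut j + l)"
    if "w i = a" "w j = b" for i j
  proof -
    \<comment> \<open>Blocks are nonempty, so \<open>Suc l\<close> of them cover position
      \<open>l\<close>.\<close>
    define u where "u = map f (map w [Suc i..<i + Suc l])"
    define v where "v = map f (map w [Suc j..<j + Suc l])"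
    have u: "morph f (map w [i..<i + Suc l]) = concat (f a # u)"
      using that by (simp add: u_def morph_def upt_rec del: upt_Suc)
    have v: "morph f (map w [j..<j + Suc l]) = concat (f b # v)"
      using that by (simp add: v_def morph_def upt_rec del: upt_Suc)
    have uv: "u \<in> lists {f a, f b}" "v \<in> lists {f a, f b}"
    proof -
      have "f c \<in> {f a, f b}" for c using UNIV_eq[OF ab] UNIV_I[of c] by auto
      then show "u \<in> lists {f a, f b}" "v \<in> lists {f a, f b}"
        unfolding u_def v_def lists_eq_set by auto
    qed
    have lu: "l < length (concat (f a # u))"
      using cut_add_ge[of i "Suc l"] cut_add[of i "Suc l"] unfolding u by linarith
    have lv: "l < length (concat (f b # v))"
      using cut_add_ge[of j "Suc l"] cut_add[of j "Suc l"] unfolding v by linarith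
    have d: "take l (concat (f a # u)) = take l (concat (f b # v))"
      "concat (f a # u) ! l \<noteq> concat (f b # v) ! l"
      using l uv lu lv unfolding diverge_at_def by blast+
    have Wu: "W (cut i + t) = concat (f a # u) ! t" if "t \<le> l" for t
      using W_cut_add[of t i "Suc l"] lu that unfolding u by simp
    have Wv: "W (cut j + t) = concat (f b # v) ! t" if "t \<le> l" for t
      using W_cut_add[of t j "Suc l"] lv that unfolding v by simp
    show ?thesis using d Wu Wv by (metis nth_take order.refl less_imp_le)
  qed
  show ?thesis
  proof (intro exI allI impI)
    fix i j assume "w i \<noteq> w j"
    moreover have "w i \<in> {a, b}" "w j \<in> {a, b}" using UNIV_eq[OF ab] by auto
    ultimately have "w i = a \<and> w j = b \<or> w j = a \<and> w i = b" by auto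
    then show "(\<forall>t<l. W (cut i + t) = W (cut j + t)) \<and> W (cut i + l) \<noteq> W (cut j + l)"
      using main by metis
  qed
qed

text \<open>The first \<open>delay\<close> letters after a cut are the same at all cuts; the letter
  after them tells which block starts there.\<close>

definition delay :: nat where
  "delay = (SOME l. \<forall>i j. w i \<noteq> w j \<longrightarrow>
     (\<forall>t<l. W (cut i + t) = W (cut j + t)) \<and> W (cut i + l) \<noteq> W (cut j + l))"

lemma W_at_delay_neq: "w i \<noteq> w j \<Longrightarrow> W (cut i + delay) \<noteq> W (cut j + delay)"
  using someI_ex[OF ex_divergence] unfolding delay_def by blast

text \<open>Different letters are covered by the choice of \<open>delay\<close>. Equal letters have
  equal blocks; if \<open>t\<close> lies beyond the block, the claim is reduced to the next cuts and
  a smaller offset.\<close>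

lemma W_before_delay_eq: "t < delay \<Longrightarrow> W (cut i + t) = W (cut j + t)"
proof (induction t arbitrary: i j rule: less_induct)
  case (less t)
  show ?case
  proof (cases "w i = w j")
    case False
    then show ?thesis using someI_ex[OF ex_divergence] less.prems unfolding delay_def by blast
  next
    case True
    show ?thesis
    proof (cases "t < length (f (w i))")
      case True
      then show ?thesis using W_block \<open>w i = w j\<close> by metis
    next
      case False
      define t' where "t' = t - length (f (w i))"
      have t: "t = length (f (w i)) + t'" "t' < t" using False length_f_pos[of "w i"] by (auto simp: t'_def)
      have "W (cut (Suc i) + t') = W (cut (Suc j) + t')" using less t by simp
      then show ?thesis using t True by (simp add: cut_Suc add.assoc)
    qed
  qed
qed

section \<open>Synchronisation of two parses\<close>

definition block :: "nat \<Rightarrow> nat" where "block p = (LEAST i. p < cut (Suc i))"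

lemma block: "cut (block p) \<le> p" "p < cut (Suc (block p))"
proof -
  have ex: "p < cut (Suc p)" using cut_add_ge[of 0 "Suc p"] cut_0 by simp
  show "p < cut (Suc (block p))" unfolding block_def by (rule LeastI[of _ p]) (rule ex)
  show "cut (block p) \<le> p"
  proof (cases "block p")
    case (Suc i)
    then have "\<not> p < cut (Suc i)" using not_less_Least[of i "\<lambda>i. p < cut (Suc i)"] by (simp add: block_def)
    then show ?thesis using Suc by simp
  qed (simp add: cut_0)
qed

lemma block_eqI: "cut i \<le> p \<Longrightarrow> p < cut (Suc i) \<Longrightarrow> block p = i"
  using block[of p] strict_mono_less[OF strict_mono_cut]
  by (metis le_less_trans less_Suc_eq_le nle_le not_less)

lemma block_cut: "block (cut i) = i"
  by (rule block_eqI) (auto simp: strict_mono_less[OF strict_mono_cut])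

text \<open>The state of the parse at \<open>p\<close>. Offsets stay below \<open>M\<close>, so
  there are finitely many states and the pigeonhole principle applies.\<close>

definition pos :: "nat \<Rightarrow> 'a \<times> nat" where
  "pos p = (w (block p), p - cut (block p))"

lemma pos_cut: "pos (cut i) = (w i, 0)"
  by (simp add: pos_def block_cut)

lemma snd_pos_less: "snd (pos p) < length (f (fst (pos p)))"
  using block[of p] by (simp add: pos_def cut_Suc)

lemma pos_Suc_inner:
  assumes "Suc (snd (pos p)) < length (f (fst (pos p)))"
  shows "pos (Suc p) = (fst (pos p), Suc (snd (pos p)))"
proof -
  have "block (Suc p) = block p"
    by (rule block_eqI) (use assms block[of p] in \<open>auto simp: pos_def cut_Suc\<close>)
  then show ?thesis using block(1)[of p] by (simp add: pos_def Suc_diff_le)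
qed

lemma Suc_eq_cut:
  assumes "\<not> Suc (snd (pos p)) < length (f (fst (pos p)))"
  shows "Suc p = cut (Suc (block p))"
  using assms block[of p] by (simp add: pos_def cut_Suc)

lemma cut_next_block: "cut (Suc (block p)) = p + (length (f (fst (pos p))) - snd (pos p))"
  using block[of p] by (simp add: pos_def cut_Suc)

text \<open>Equal states have the same rest of the block; the cuts that end these blocks are
  followed by the same \<open>delay\<close> letters.\<close>

lemma W_after_pos:
  assumes "pos p = pos q" and "p + t < cut (Suc (block p)) + delay"
  shows "W (p + t) = W (q + t)"
proof (cases "p + t < cut (Suc (block p))")
  case True
  have "W (r + t) = f (fst (pos r)) ! (snd (pos r) + t)"
    if "t + snd (pos r) < length (f (fst (pos r)))" for r
    using W_block[of "snd (pos r) + t" "block r"] block(1)[of r] that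
    by (simp add: pos_def add.commute)
  moreover have "t + snd (pos p) < length (f (fst (pos p)))"
    using True cut_next_block[of p] by linarith
  ultimately show ?thesis using assms(1) by metis
next
  case False
  define t' where "t' = p + t - cut (Suc (block p))"
  have t': "p + t = cut (Suc (block p)) + t'" "t' < delay"
    using False assms(2) by (auto simp: t'_def)
  have "q + t = cut (Suc (block q)) + t'"
    using t' cut_next_block[of p] cut_next_block[of q] assms(1) by simp
  then show ?thesis using W_before_delay_eq t' by metis
qed

text \<open>The overhang is nonempty, so the texts that follow it agree strictly beyond the point where
  two different letters at the cut would have to diverge.\<close>

lemma pos_Suc_determined:
  assumes "pos p = pos q" "pos p' = pos q'"
    and "\<And>t. t \<le> Suc delay \<Longrightarrow> W (p + t) = W (p' + t)"
    and "\<And>t. t \<le> Suc delay \<Longrightarrow> W (q + t) = W (q' + t)"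
    and "\<not> (Suc p \<in> range cut \<and> Suc p' \<in> range cut)"
  shows "pos (Suc p) = pos (Suc q)"
proof (cases "Suc (snd (pos p)) < length (f (fst (pos p)))")
  case True
  then show ?thesis using pos_Suc_inner[of p] pos_Suc_inner[of q] assms(1) by simp
next
  case False
  \<comment> \<open>Both unprimed parses finish a block here, so only the letter of the next block
    is in question.\<close>
  define i j where "i = Suc (block p)" and "j = Suc (block q)"
  have ij: "Suc p = cut i" "Suc q = cut j"
    using Suc_eq_cut False assms(1) by (auto simp: i_def j_def)
  then have "Suc (snd (pos p')) < length (f (fst (pos p')))"
    using assms(5) Suc_eq_cut[of p'] by (metis rangeI)
  then have "Suc p' < cut (Suc (block p'))" using cut_next_block[of p'] by linarith
  then have "W (p' + Suc delay) = W (q' + Suc delay)"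
    by (intro W_after_pos assms(2)) simp
  then have "W (p + Suc delay) = W (q + Suc delay)"
    using assms(3)[of "Suc delay"] assms(4)[of "Suc delay"] by simp
  then have "W (cut i + delay) = W (cut j + delay)"
    using ij by (metis add_Suc_shift)
  then have "w i = w j" using W_at_delay_neq by blast
  then show ?thesis using ij pos_cut by simp
qed

text \<open>Without a common cut, the pair of states of the two parses evolves deterministically. A
  repeated pair makes the evolution periodic, and the blocks met by the first parse then form a
  stretch of \<open>w\<close> with a short period, longer than \<open>bounded_periods\<close>
  permits.\<close>

lemma ex_common_cut:
  assumes "bounded_periods w"
  shows "\<exists>L. \<forall>P P'. (\<forall>t<L. W (P + t) = W (P' + t)) \<longrightarrow>
           (\<exists>t<L. P + t \<in> range cut \<and> P' + t \<in> range cut)"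
proof -
  define A :: "(('a \<times> nat) \<times> ('a \<times> nat)) set" where
    "A = (UNIV \<times> {..<M}) \<times> (UNIV \<times> {..<M})"
  define N where "N = card A"
  have finA: "finite A" by (simp add: A_def)
  obtain K where K: "\<And>i n q. 1 \<le> q \<Longrightarrow> q \<le> N \<Longrightarrow> has_period_on w i n q \<Longrightarrow> n < K"
    using assms unfolding bounded_periods_def by blast
  \<comment> \<open>Room for finding a repeated pair of states (\<open>N\<close>), for the blocks
    that follow it (\<open>M * Suc K\<close>), and for the look-ahead of
    \<open>pos_Suc_determined\<close>.\<close>
  define L where "L = N + M * Suc K + delay + 2"
  show ?thesis
  proof (rule exI[of _ L], intro allI impI, rule ccontr)
    fix P P' assume agree: "\<forall>t<L. W (P + t) = W (P' + t)"
      and nocut: "\<not> (\<exists>t<L. P + t \<in> range cut \<and> P' + t \<in> range cut)"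
    define S where "S t = (pos (P + t), pos (P' + t))" for t
    have "snd (pos p) < M" for p
      using less_le_trans[OF snd_pos_less length_f_le] .
    then have "S t \<in> A" for t by (simp add: S_def A_def mem_Times_iff)
    then have "S ` {..N} \<subseteq> A" by blast
    then have "card (S ` {..N}) \<le> N" unfolding N_def by (intro card_mono finA)
    then have "\<not> inj_on S {..N}" by (metis card_image card_atMost not_less_eq_eq order.refl)
    then obtain t0 t1 where t01: "t0 < t1" "t1 \<le> N" "S t0 = S t1"
      unfolding inj_on_def by (metis atMost_iff linorder_neqE_nat)
    \<comment> \<open>Each parse serves as the context of the other, so both components of the pair
      advance together.\<close>
    have per: "t1 + d + delay + 1 < L \<Longrightarrow> S (t0 + d) = S (t1 + d)" for d
    proof (induction d)
      case (Suc d)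
      then have IH: "S (t0 + d) = S (t1 + d)" by simp
      have ag: "W (P + t + s) = W (P' + t + s)" if "t \<le> t1 + d" "s \<le> Suc delay" for t s
        using agree that Suc.prems by (simp add: add.assoc)
      have nc: "\<not> (Suc (P + (t0 + d)) \<in> range cut \<and> Suc (P' + (t0 + d)) \<in> range cut)"
        using nocut Suc.prems t01(1) by (auto dest!: spec[of _ "Suc (t0 + d)"])
      have "pos (Suc (P + (t0 + d))) = pos (Suc (P + (t1 + d)))"
        by (rule pos_Suc_determined[where p' = "P' + (t0 + d)" and q' = "P' + (t1 + d)"])
          (use IH ag nc t01(1) in \<open>auto simp: S_def\<close>)
      moreover have "pos (Suc (P' + (t0 + d))) = pos (Suc (P' + (t1 + d)))"
        by (rule pos_Suc_determined[where p' = "P + (t0 + d)" and q' = "P + (t1 + d)"])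
          (use IH ag nc t01(1) in \<open>auto simp: S_def\<close>)
      ultimately show ?case by (simp add: S_def)
    qed (use t01 in simp)
    define p where "p = t1 - t0"
    \<comment> \<open>These index the first cuts after the two occurrences of the repeated pair; by
      equality of states both lie at the same distance \<open>r\<close>.\<close>
    define i0 i1 where "i0 = Suc (block (P + t0))" and "i1 = Suc (block (P + t1))"
    have pos01: "pos (P + t0) = pos (P + t1)" using t01(3) by (simp add: S_def)
    define r where "r = length (f (fst (pos (P + t0)))) - snd (pos (P + t0))"
    have c0: "cut i0 = P + t0 + r" "cut i1 = P + t1 + r" "r \<le> M"
      using cut_next_block[of "P + t0"] cut_next_block[of "P + t1"] pos01
        length_f_le[of "fst (pos (P + t0))"] by (auto simp: i0_def i1_def r_def)
    have next_eq: "w (i0 + m) = w (i1 + m)" if "cut (i1 + m) = cut (i0 + m) + p" "m < K" for m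
    proof -
      define d where "d = r + (cut (i0 + m) - cut i0)"
      have "d \<le> M + M * m" using cut_add_le[of i0 m] c0(3) by (simp add: d_def)
      also have "\<dots> \<le> M * Suc K" using that(2) by (simp flip: mult_Suc_right)
      finally have "t1 + d + delay + 1 < L" using t01 by (simp add: L_def)
      from per[OF this] have "pos (P + (t0 + d)) = pos (P + (t1 + d))" by (simp add: S_def)
      moreover have "P + (t0 + d) = cut (i0 + m)"
        using c0 cut_add_ge[of i0 m] by (simp add: d_def)
      moreover have "P + (t1 + d) = cut (i1 + m)"
        using c0 cut_add_ge[of i0 m] that(1) t01(1) by (simp add: d_def p_def)
      ultimately show ?thesis by (simp add: pos_cut)
    qed
    \<comment> \<open>Equal letters have blocks of equal length, so the shift \<open>p\<close>
      between the cuts persists and \<open>next_eq\<close> applies again.\<close>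
    have cuts: "m \<le> K \<Longrightarrow> cut (i1 + m) = cut (i0 + m) + p" for m
    proof (induction m)
      case 0
      then show ?case using c0 t01(1) by (simp add: p_def)
    next
      case (Suc m)
      then show ?case using next_eq[of m] by (simp add: cut_Suc)
    qed
    have "cut i0 < cut i1" using c0 t01(1) by simp
    then have "i0 < i1" using strict_mono_less[OF strict_mono_cut] by blast
    define q where "q = i1 - i0"
    have q: "i1 = i0 + q" "1 \<le> q" using \<open>i0 < i1\<close> by (auto simp: q_def)
    \<comment> \<open>Nonempty blocks give \<open>q \<le> p\<close>, and
      \<open>p \<le> t1 \<le> N\<close>.\<close>
    have "q \<le> N" using cut_add_ge[of i0 q] cuts[of 0] q t01(2) by (simp add: p_def)
    moreover have "has_period_on w i0 (K + q) q"
      unfolding has_period_on_def using next_eq cuts q by (simp add: add_ac)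
    ultimately have "K + q < K" using K q by blast
    then show False by simp
  qed
qed

text \<open>The texts at \<open>P\<close> and \<open>P + q\<close> agree, so they share a cut after
  fewer than \<open>L\<close> letters. From there the parses coincide up to the first pair of
  different letters, which must lie within \<open>delay\<close> letters of the end of the agreement.
  Hence the loss \<open>L + delay\<close> at the two ends.\<close>

lemma desubstitute_repetition:
  assumes "bounded_periods w"
  shows "\<exists>C. \<forall>P n q. 1 \<le> q \<longrightarrow> q + C \<le> n \<longrightarrow> has_period_on W P n q \<longrightarrow>
    (\<exists>i k m. 1 \<le> k \<and> k \<le> m \<and> has_period_on w i m k \<and>
       cut (i + k) = cut i + q \<and> n + cut i \<le> cut (i + m) + C)"
proof -
  obtain L where L: "\<And>P P'. (\<And>t. t < L \<Longrightarrow> W (P + t) = W (P' + t)) \<Longrightarrow>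
           \<exists>t<L. P + t \<in> range cut \<and> P' + t \<in> range cut"
    using ex_common_cut[OF assms] by blast
  show ?thesis
  proof (rule exI[of _ "L + delay"], intro allI impI)
    fix P n q assume q: "1 \<le> q" "q + (L + delay) \<le> n" "has_period_on W P n q"
    have agree: "W (P + t) = W (P + q + t)" if "t + q < n" for t
      using q(3) that unfolding has_period_on_def by (metis add.assoc add.commute)
    have "\<exists>t<L. P + t \<in> range cut \<and> P + q + t \<in> range cut"
      by (rule L) (use agree q in auto)
    then obtain t i i' where t: "t < L" "P + t = cut i" "P + q + t = cut i'" by auto
    have "cut i < cut i'" using t q by simp
    then have "i < i'" using strict_mono_less[OF strict_mono_cut] by blast
    define k where "k = i' - i"
    have k: "i' = i + k" "1 \<le> k" using \<open>i < i'\<close> by (auto simp: k_def)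
    \<comment> \<open>Here \<open>m\<close> counts common blocks. If the first \<open>n\<close>
      letters coincide, \<open>m = n\<close> suffices because their image has length at least
      \<open>n\<close>; otherwise \<open>m\<close> is the first mismatch.\<close>
    have "\<exists>m. (\<forall>x<m. w (i + x) = w (i' + x)) \<and> P + n \<le> cut (i + m) + q + delay"
    proof (cases "\<forall>x<n. w (i + x) = w (i' + x)")
      case True
      then show ?thesis using cut_add_ge[of i n] t by (intro exI[of _ n]) auto
    next
      case False
      define m where "m = (LEAST x. w (i + x) \<noteq> w (i' + x))"
      have m: "w (i + m) \<noteq> w (i' + m)" unfolding m_def by (rule LeastI_ex) (use False in blast)
      have lt: "w (i + x) = w (i' + x)" if "x < m" for x
        using not_less_Least[of x "\<lambda>x. w (i + x) \<noteq> w (i' + x)"] that unfolding m_def by blast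
      have cuts: "x \<le> m \<Longrightarrow> cut (i' + x) = cut (i + x) + q" for x
        by (induction x) (use t lt in \<open>auto simp: cut_Suc\<close>)
      have "P + n \<le> cut (i + m) + q + delay"
      proof (rule ccontr)
        assume less: "\<not> ?thesis"
        have "P + t \<le> cut (i + m)" using t cut_add_ge[of i m] by simp
        then have "W (cut (i + m) + delay) = W (cut (i + m) + q + delay)"
          using agree[of "cut (i + m) + delay - P"] less by (simp add: add_ac)
        then show False using W_at_delay_neq[OF m] cuts[of m] by simp
      qed
      then show ?thesis using lt by blast
    qed
    then obtain m where m: "\<And>x. x < m \<Longrightarrow> w (i + x) = w (i' + x)" "P + n \<le> cut (i + m) + q + delay"
      by blast
    have cuts: "x \<le> m \<Longrightarrow> cut (i' + x) = cut (i + x) + q" for x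
      by (induction x) (use t m(1) in \<open>auto simp: cut_Suc\<close>)
    have "has_period_on w i (k + m) k"
      using m(1) unfolding has_period_on_def k by (simp add: add_ac)
    moreover have "cut (i + k) = cut i + q" using t k by simp
    moreover have "n + cut i \<le> cut (i + (k + m)) + (L + delay)"
      using m(2) cuts[of m] k t by (simp add: add_ac)
    ultimately show "\<exists>i k m. 1 \<le> k \<and> k \<le> m \<and> has_period_on w i m k \<and>
       cut (i + k) = cut i + q \<and> n + cut i \<le> cut (i + m) + (L + delay)"
      using k(2) le_add1 by blast
  qed
qed

section \<open>Lengths of images of repetitions\<close>

text \<open>The constant loss of desubstitution is negligible: long repetitions with short periods
  are excluded, so the loss is at most \<open>\<epsilon> / 2\<close> times the period.\<close>

lemma ACE_image_le:
  fixes e :: real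
  assumes bp: "bounded_periods w" and e: "e \<ge> 1"
    and lengths: "\<And>\<epsilon>. \<epsilon> > 0 \<Longrightarrow> \<exists>m0. \<forall>i k m. m0 \<le> m \<longrightarrow> 1 \<le> k \<longrightarrow> k \<le> m \<longrightarrow>
        has_period_on w i m k \<longrightarrow>
        real (cut (i + m) - cut i) \<le> (e + \<epsilon>) * real (cut (i + k) - cut i)"
  shows "ACE W \<le> ereal e"
proof (rule ereal_le_epsilon2)
  fix \<epsilon> :: real assume \<epsilon>: "0 < \<epsilon>"
  obtain C where C: "\<And>P n q. 1 \<le> q \<Longrightarrow> q + C \<le> n \<Longrightarrow> has_period_on W P n q \<Longrightarrow>
    \<exists>i k m. 1 \<le> k \<and> k \<le> m \<and> has_period_on w i m k \<and>
       cut (i + k) = cut i + q \<and> n + cut i \<le> cut (i + m) + C"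
    using desubstitute_repetition[OF bp] by blast
  obtain m0 where m0: "\<And>i k m. m0 \<le> m \<Longrightarrow> 1 \<le> k \<Longrightarrow> k \<le> m \<Longrightarrow> has_period_on w i m k \<Longrightarrow>
        real (cut (i + m) - cut i) \<le> (e + \<epsilon> / 2) * real (cut (i + k) - cut i)"
    using lengths[of "\<epsilon> / 2"] \<epsilon> by (meson half_gt_zero)
  obtain Q :: nat where "2 * real C / \<epsilon> < real Q" using reals_Archimedean2 by blast
  then have CQ: "real C \<le> \<epsilon> / 2 * real q" if "Q \<le> q" for q
  proof -
    have "2 * real C / \<epsilon> < real q" using \<open>2 * real C / \<epsilon> < real Q\<close> that by linarith
    then show ?thesis using \<epsilon> by (simp add: divide_less_eq mult.commute)
  qed
  obtain K where K: "\<And>i n q. 1 \<le> q \<Longrightarrow> q \<le> Q \<Longrightarrow> has_period_on w i n q \<Longrightarrow> n < K"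
    using bp unfolding bounded_periods_def by blast
  \<comment> \<open>\<open>Q + C\<close> handles periods close to \<open>n\<close>,
    \<open>M * K + C\<close> rules out periods up to \<open>Q\<close>, and \<open>M * m0 + C\<close>
    forces \<open>m0 \<le> m\<close>.\<close>
  define n0 where "n0 = Q + C + M * K + M * m0 + 1"
  have "ACE W \<le> ereal (e + \<epsilon>)"
  proof (rule ACE_leI[of _ n0])
    show "1 \<le> e + \<epsilon>" using e \<epsilon> by simp
    fix n P q assume n: "n0 \<le> n" and q: "1 \<le> q" "q \<le> n" "has_period_on W P n q"
    show "real n \<le> (e + \<epsilon>) * real q"
    proof (cases "q + C \<le> n")
      case False
      then have "Q \<le> q" using n by (simp add: n0_def)
      then have "real n \<le> (1 + \<epsilon> / 2) * real q" using CQ[of q] False by (simp add: algebra_simps)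
      also have "\<dots> \<le> (e + \<epsilon>) * real q" using e \<epsilon> by (intro mult_right_mono) auto
      finally show ?thesis .
    next
      case True
      obtain i k m where ikm: "1 \<le> k" "k \<le> m" "has_period_on w i m k"
        "cut (i + k) = cut i + q" "n + cut i \<le> cut (i + m) + C"
        using C[OF q(1) True q(3)] by blast
      have nM: "n \<le> M * m + C" using ikm(5) cut_add_le[of i m] by linarith
      have "Q < q"
      proof (rule ccontr)
        assume "\<not> Q < q"
        moreover have "k \<le> q" using cut_add_ge[of i k] ikm(4) by linarith
        ultimately have "m < K" using K[OF ikm(1) _ ikm(3)] by linarith
        then have "M * m \<le> M * K" by simp
        then show False using nM n unfolding n0_def by linarith
      qed
      have "M * m0 < M * m" using nM n unfolding n0_def by linarith
      then have "m0 \<le> m" by simp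
      from m0[OF this ikm(1-3)]
      have "real (cut (i + m) - cut i) \<le> (e + \<epsilon> / 2) * real q" using ikm(4) by simp
      moreover have "real n \<le> real (cut (i + m) - cut i) + real C"
        using ikm(5) by linarith
      ultimately show ?thesis using CQ[of q] \<open>Q < q\<close> by (simp add: algebra_simps)
    qed
  qed
  then show "ACE W \<le> ereal e + ereal \<epsilon>" by simp
qed

text \<open>Letters one period apart have blocks of equal length. The additive form avoids truncated
  subtraction.\<close>

lemma cut_period_shift:
  assumes "has_period_on w i m k"
  shows "x + k \<le> m \<Longrightarrow> cut (i + k + x) + cut i = cut (i + x) + cut (i + k)"
proof (induction x)
  case (Suc x)
  then have "w (i + x) = w (i + k + x)"
    using assms unfolding has_period_on_def by (metis Suc_le_eq add.assoc add.commute add_Suc)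
  then show ?case using Suc by (simp add: cut_Suc)
qed simp

lemma cut_period_div:
  assumes "has_period_on w i m k" "j * k + r \<le> m"
  shows "cut (i + (j * k + r)) - cut i = j * (cut (i + k) - cut i) + (cut (i + r) - cut i)"
  using assms(2)
proof (induction j)
  case (Suc j)
  have "cut (i + k + (j * k + r)) + cut i = cut (i + (j * k + r)) + cut (i + k)"
    by (rule cut_period_shift[OF assms(1)]) (use Suc.prems in simp)
  moreover have "cut i \<le> cut (i + (j * k + r))" "cut i \<le> cut (i + k)"
    using cut_add_ge[of i "j * k + r"] cut_add_ge[of i k] by linarith+
  moreover have "i + (Suc j * k + r) = i + k + (j * k + r)" by simp
  moreover have "cut (i + (j * k + r)) - cut i = j * (cut (i + k) - cut i) + (cut (i + r) - cut i)"
    using Suc by simp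
  ultimately show ?case by (simp only: mult_Suc)
qed simp

text \<open>The incomplete last period is a prefix of the period, so its image is at most as long as
  that of a full one.\<close>

lemma cut_diff_le_of_few_periods:
  assumes "has_period_on w i m k" "1 \<le> k" "m div k < K"
  shows "real (cut (i + m) - cut i) \<le> real K * real (cut (i + k) - cut i)"
proof -
  have "cut (i + m) - cut i = m div k * (cut (i + k) - cut i) + (cut (i + m mod k) - cut i)"
    using cut_period_div[OF assms(1), of "m div k" "m mod k"] by simp
  also have "cut (i + m mod k) \<le> cut (i + k)"
    using assms(2) by (simp add: strict_mono_less_eq[OF strict_mono_cut] less_imp_le)
  finally have "cut (i + m) - cut i \<le> Suc (m div k) * (cut (i + k) - cut i)"
    by (simp add: diff_le_mono)
  also have "\<dots> \<le> K * (cut (i + k) - cut i)" using assms(3) by (intro mult_right_mono) auto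
  finally show ?thesis by (metis of_nat_le_iff of_nat_mult)
qed

lemma ACE_image_le_nat:
  assumes "ACE w = ereal (real K)"
  shows "ACE W \<le> ACE w"
proof -
  have bp: "bounded_periods w" by (rule bounded_periods_if_ACE_finite) (simp add: assms)
  have K: "1 \<le> real K" using ACE_ge_1[of w] assms by (simp add: one_ereal_def)
  have "ACE W \<le> ereal (real K)"
  proof (rule ACE_image_le[OF bp K])
    fix \<epsilon> :: real assume \<epsilon>: "0 < \<epsilon>"
    \<comment> \<open>A remainder of at most \<open>\<delta> * k\<close> letters has an image of
      length at most \<open>M * \<delta> * k\<close>, which is to stay below
      \<open>\<epsilon> * k\<close>.\<close>
    define \<delta> where "\<delta> = min (1/2) (\<epsilon> / real (Suc M))"
    have \<delta>: "0 < \<delta>" "\<delta> < 1" "real M * \<delta> \<le> \<epsilon>"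
    proof -
      show "0 < \<delta>" "\<delta> < 1" using \<epsilon> by (auto simp: \<delta>_def)
      have "real M * \<delta> \<le> real (Suc M) * (\<epsilon> / real (Suc M))"
        using \<epsilon> by (intro mult_mono) (auto simp: \<delta>_def)
      then show "real M * \<delta> \<le> \<epsilon>" by simp
    qed
    have "ACE w < ereal (real K + \<delta>)" using assms \<delta> by simp
    then obtain m0 where m0: "\<And>m i k. m \<ge> m0 \<Longrightarrow> 1 \<le> k \<Longrightarrow> k \<le> m \<Longrightarrow> has_period_on w i m k \<Longrightarrow>
        real m \<le> (real K + \<delta>) * real k" using ACE_lessD by blast
    show "\<exists>m0. \<forall>i k m. m0 \<le> m \<longrightarrow> 1 \<le> k \<longrightarrow> k \<le> m \<longrightarrow> has_period_on w i m k \<longrightarrow>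
        real (cut (i + m) - cut i) \<le> (real K + \<epsilon>) * real (cut (i + k) - cut i)"
    proof (intro exI allI impI)
      fix i k m assume m: "m0 \<le> m" "1 \<le> k" "k \<le> m" "has_period_on w i m k"
      show "real (cut (i + m) - cut i) \<le> (real K + \<epsilon>) * real (cut (i + k) - cut i)"
      proof (cases "m div k < K")
        case True
        have "real (cut (i + m) - cut i) \<le> real K * real (cut (i + k) - cut i)"
          by (rule cut_diff_le_of_few_periods[OF m(4,2) True])
        also have "\<dots> \<le> (real K + \<epsilon>) * real (cut (i + k) - cut i)"
          using \<epsilon> by (intro mult_right_mono) auto
        finally show ?thesis .
      next
        case False
        define r where "r = m - K * k"
        have "K * k \<le> m div k * k" using False by simp
        also have "\<dots> \<le> m" by (rule div_times_less_eq_dividend)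
        finally have Kk: "m = K * k + r" by (simp add: r_def)
        have r: "real r \<le> \<delta> * real k" using m0[OF m] Kk by (simp add: algebra_simps)
        have "real (cut (i + r) - cut i) \<le> real M * real r"
          using cut_add_le[of i r] by (simp flip: of_nat_mult)
        also have "\<dots> \<le> real M * (\<delta> * real k)" using r by (intro mult_left_mono) auto
        also have "\<dots> \<le> \<epsilon> * real k" using \<delta>(3) by (metis mult.assoc mult_right_mono of_nat_0_le_iff)
        also have "\<dots> \<le> \<epsilon> * real (cut (i + k) - cut i)"
          using \<epsilon> cut_add_ge[of i k] by (intro mult_left_mono) auto
        finally have "real (cut (i + r) - cut i) \<le> \<epsilon> * real (cut (i + k) - cut i)" .
        moreover have "cut (i + m) - cut i = K * (cut (i + k) - cut i) + (cut (i + r) - cut i)"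
          using cut_period_div[OF m(4), of K r] Kk by simp
        ultimately show ?thesis by (simp add: distrib_right)
      qed
    qed
  qed
  then show ?thesis using assms by simp
qed

text \<open>If images have length about \<open>\<mu>\<close> per letter, uniformly in the position,
  then the ratio of the image lengths of a repetition and its period is close to
  \<open>m / k\<close>.\<close>

lemma ACE_image_le_of_mean_length:
  fixes s \<mu> :: real
  assumes ACE: "ACE w = ereal s"
    and mean: "\<And>\<eta>. \<eta> > 0 \<Longrightarrow> \<exists>n0. \<forall>n\<ge>n0. \<forall>i. \<bar>real (cut (i + n) - cut i) - \<mu> * real n\<bar> \<le> \<eta> * real n"
  shows "ACE W \<le> ACE w"
proof -
  have bp: "bounded_periods w" by (rule bounded_periods_if_ACE_finite) (simp add: ACE)
  have s: "1 \<le> s" using ACE_ge_1[of w] ACE by (simp add: one_ereal_def)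
  have \<mu>: "1 / 2 \<le> \<mu>"
  proof -
    obtain n0 where n0: "\<forall>n\<ge>n0. \<forall>i. \<bar>real (cut (i + n) - cut i) - \<mu> * real n\<bar> \<le> 1 / 2 * real n"
      using mean[of "1/2"] by auto
    obtain N where N: "n0 \<le> N" "1 \<le> N" by (meson nat_le_linear order.trans)
    have "\<bar>real (cut (0 + N) - cut 0) - \<mu> * real N\<bar> \<le> 1 / 2 * real N"
      using n0 N(1) by blast
    moreover have "real N \<le> real (cut (0 + N) - cut 0)"
      using cut_add_ge[of 0 N] by (intro of_nat_mono) simp
    ultimately have "1 / 2 * real N \<le> \<mu> * real N" by linarith
    then show ?thesis by (rule mult_right_le_imp_le) (use N in simp)
  qed
  have "ACE W \<le> ereal s"
  proof (rule ACE_image_le[OF bp s])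
    fix \<epsilon> :: real assume \<epsilon>: "0 < \<epsilon>"
    \<comment> \<open>Replacing \<open>\<mu>\<close> by \<open>\<mu> + \<eta>\<close> and
      \<open>\<mu> - \<eta>\<close> costs at most \<open>\<epsilon> / 8\<close> each, covered by
      \<open>\<mu> * \<epsilon> / 2 \<ge> \<epsilon> / 4\<close>.\<close>
    define \<eta> where "\<eta> = \<epsilon> / (8 * (s + \<epsilon>))"
    have \<eta>: "0 < \<eta>" "\<eta> * (s + \<epsilon>) = \<epsilon> / 8" using \<epsilon> s by (auto simp: \<eta>_def field_simps)
    have "(\<mu> + \<eta>) * (s + \<epsilon> / 2) = \<mu> * (s + \<epsilon> / 2) + \<eta> * (s + \<epsilon> / 2)" by (simp add: algebra_simps)
    also have "\<dots> \<le> \<mu> * (s + \<epsilon> / 2) + \<eta> * (s + \<epsilon>)" using \<eta> \<epsilon> by simp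
    also have "\<dots> \<le> \<mu> * (s + \<epsilon>) - \<eta> * (s + \<epsilon>)"
    proof -
      have "1 / 2 * (\<epsilon> / 2) \<le> \<mu> * (\<epsilon> / 2)" using \<mu> \<epsilon> by (intro mult_right_mono) auto
      then show ?thesis unfolding \<eta>(2) by (simp add: algebra_simps)
    qed
    finally have key: "(\<mu> + \<eta>) * (s + \<epsilon> / 2) \<le> (s + \<epsilon>) * (\<mu> - \<eta>)" by (simp add: algebra_simps)
    have "ACE w < ereal (s + \<epsilon> / 2)" using ACE \<epsilon> by simp
    then obtain m0 where m0: "\<And>m i k. m \<ge> m0 \<Longrightarrow> 1 \<le> k \<Longrightarrow> k \<le> m \<Longrightarrow> has_period_on w i m k \<Longrightarrow>
        real m \<le> (s + \<epsilon> / 2) * real k" using ACE_lessD by blast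
    obtain n0 where n0: "\<And>n i. n \<ge> n0 \<Longrightarrow> \<bar>real (cut (i + n) - cut i) - \<mu> * real n\<bar> \<le> \<eta> * real n"
      using mean[OF \<eta>(1)] by blast
    obtain K where K: "\<And>i n q. 1 \<le> q \<Longrightarrow> q \<le> n0 \<Longrightarrow> has_period_on w i n q \<Longrightarrow> n < K"
      using bp unfolding bounded_periods_def by blast
    show "\<exists>m0. \<forall>i k m. m0 \<le> m \<longrightarrow> 1 \<le> k \<longrightarrow> k \<le> m \<longrightarrow> has_period_on w i m k \<longrightarrow>
        real (cut (i + m) - cut i) \<le> (s + \<epsilon>) * real (cut (i + k) - cut i)"
    proof (intro exI[of _ "m0 + K"] allI impI)
      fix i k m assume m: "m0 + K \<le> m" "1 \<le> k" "k \<le> m" "has_period_on w i m k"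
      \<comment> \<open>The mean length must be accurate for the period too; shorter periods cannot
        extend over \<open>K\<close> letters.\<close>
      have k: "n0 \<le> k" using K[OF m(2) _ m(4)] m(1) by (meson add_leD2 leD nat_le_linear)
      have "real (cut (i + m) - cut i) \<le> (\<mu> + \<eta>) * real m"
        using n0[of m i] k m(3) by (simp add: algebra_simps abs_le_iff)
      also have "\<dots> \<le> (\<mu> + \<eta>) * ((s + \<epsilon> / 2) * real k)"
        using m0[of m k i] m \<mu> \<eta>(1) by (intro mult_left_mono) auto
      also have "\<dots> = (\<mu> + \<eta>) * (s + \<epsilon> / 2) * real k" by simp
      also have "\<dots> \<le> (s + \<epsilon>) * (\<mu> - \<eta>) * real k" using key by (intro mult_right_mono) auto
      also have "\<dots> = (s + \<epsilon>) * ((\<mu> - \<eta>) * real k)" by simp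
      also have "\<dots> \<le> (s + \<epsilon>) * real (cut (i + k) - cut i)"
        using n0[of k i] k s \<epsilon> by (intro mult_left_mono) (auto simp: algebra_simps abs_le_iff)
      finally show "real (cut (i + m) - cut i) \<le> (s + \<epsilon>) * real (cut (i + k) - cut i)" .
    qed
  qed
  then show ?thesis using ACE by simp
qed

lemma cut_diff_eq_sum:
  "cut (i + n) - cut i = (\<Sum>a\<in>UNIV. length (f a) * count_letter a (map w [i..<i+n]))"
  by (simp add: cut_add length_morph_eq_sum)

lemma ACE_image_le_of_freq:
  fixes \<phi> :: "'a \<Rightarrow> real"
  assumes "ACE w = ereal s"
    and freq: "\<And>a \<eta>. \<eta> > 0 \<Longrightarrow> \<exists>n0. \<forall>n\<ge>n0. \<forall>i.
      \<bar>real (count_letter a (map w [i..<i+n])) - \<phi> a * real n\<bar> \<le> \<eta> * real n"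
  shows "ACE W \<le> ACE w"
proof (rule ACE_image_le_of_mean_length[OF assms(1), of "\<Sum>a\<in>UNIV. real (length (f a)) * \<phi> a"])
  fix \<eta> :: real assume \<eta>: "0 < \<eta>"
  define \<eta>' where "\<eta>' = \<eta> / real (Suc M)"
  have \<eta>': "0 < \<eta>'" "real M * \<eta>' \<le> \<eta>" using \<eta> by (auto simp: \<eta>'_def field_simps)
  have "\<forall>a. \<exists>n0. \<forall>n\<ge>n0. \<forall>i. \<bar>real (count_letter a (map w [i..<i+n])) - \<phi> a * real n\<bar> \<le> \<eta>' * real n"
    using freq[OF \<eta>'(1)] by blast
  then obtain N where N: "\<And>a n i. n \<ge> N a \<Longrightarrow>
      \<bar>real (count_letter a (map w [i..<i+n])) - \<phi> a * real n\<bar> \<le> \<eta>' * real n" by metis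
  show "\<exists>n0. \<forall>n\<ge>n0. \<forall>i.
     \<bar>real (cut (i + n) - cut i) - (\<Sum>a\<in>UNIV. real (length (f a)) * \<phi> a) * real n\<bar> \<le> \<eta> * real n"
  proof (intro exI[of _ "\<Sum>a\<in>UNIV. N a"] allI impI)
    fix n i assume n: "(\<Sum>a\<in>UNIV. N a) \<le> n"
    have Na: "N a \<le> n" for a using n member_le_sum[of a UNIV N] by simp
    have "real (cut (i + n) - cut i) - (\<Sum>a\<in>UNIV. real (length (f a)) * \<phi> a) * real n =
      (\<Sum>a\<in>UNIV. real (length (f a)) * (real (count_letter a (map w [i..<i+n])) - \<phi> a * real n))"
      unfolding cut_diff_eq_sum by (simp add: sum_distrib_right right_diff_distrib sum_subtractf mult.assoc)
    also have "\<bar>\<dots>\<bar> \<le> (\<Sum>a\<in>UNIV. real (length (f a)) * (\<eta>' * real n))"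
      by (rule order.trans[OF sum_abs])
        (auto intro!: sum_mono mult_left_mono N Na simp: abs_mult)
    also have "\<dots> = real M * \<eta>' * real n" by (simp add: M_def sum_distrib_right mult.assoc)
    also have "\<dots> \<le> \<eta> * real n" using \<eta>'(2) by (intro mult_right_mono) auto
    finally show "\<bar>real (cut (i + n) - cut i) - (\<Sum>a\<in>UNIV. real (length (f a)) * \<phi> a) * real n\<bar> \<le> \<eta> * real n" .
  qed
qed

text \<open>With two letters, a factor of length \<open>B\<close> that misses \<open>a\<close> would
  be constant, against \<open>gap\<close>. Cutting the factor into chunks of length \<open>B\<close>
  gives one occurrence per chunk.\<close>

lemma count_letter_ge_div:
  assumes gap: "\<And>i n. has_period_on w i n 1 \<Longrightarrow> n < B"
  shows "n div B \<le> count_letter a (map w [i..<i+n])"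
proof -
  have occ: "1 \<le> count_letter a (map w [i..<i+B])" for i
  proof (rule ccontr)
    assume "\<not> ?thesis"
    then have "filter (\<lambda>b. b = a) (map w [i..<i+B]) = []"
      unfolding count_letter_def by (metis less_one length_0_conv not_le)
    then have na: "\<And>x. i \<le> x \<Longrightarrow> x < i + B \<Longrightarrow> w x \<noteq> a" by (auto simp: filter_empty_conv)
    have "w x = w y" if "i \<le> x" "x < i + B" "i \<le> y" "y < i + B" for x y
    proof -
      have "w y \<in> {a, w x}" using UNIV_eq[of a "w x"] na[of x] that by auto
      then show ?thesis using na[of y] that by auto
    qed
    then have "has_period_on w i B 1" by (simp add: has_period_on_def)
    then show False using gap by blast
  qed
  have "j \<le> count_letter a (map w [i..<i+j*B])" for j
  proof (induction j)
    case (Suc j)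
    have "[i..<i+Suc j*B] = [i..<i+j*B] @ [i+j*B..<i+j*B+B]"
      by (subst upt_append[of i "i+j*B"]) (auto simp: add_ac)
    then have "count_letter a (map w [i..<i+Suc j*B]) =
        count_letter a (map w [i..<i+j*B]) + count_letter a (map w [i+j*B..<i+j*B+B])"
      by (simp add: count_letter_def)
    then show ?case using Suc.IH occ[of "i+j*B"] by simp
  qed simp
  note this[of "n div B"]
  also have "count_letter a (map w [i..<i+n div B*B]) \<le> count_letter a (map w [i..<i+n])"
    by (subst (2) upt_append[of i "i+n div B*B"]) (auto simp: count_letter_def)
  finally show ?thesis .
qed

text \<open>The bound \<open>B\<close> on the gaps between occurrences of a letter depends on \<open>w\<close> only, and
  \<open>M * (n div B) \<le> |h(u)| \<le> M * n\<close> for every factor \<open>u\<close> of length \<open>n\<close>. Hence the gain below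
  the next integer is independent of the morphism.\<close>

lemma ACE_image_le_below_ceiling:
  fixes s \<rho> \<theta> :: real
  assumes ACE: "ACE w = ereal s" and K: "1 \<le> K" and s: "s < real K + \<rho>" and \<rho>: "0 \<le> \<rho>" "\<rho> < 1"
    and gap: "\<And>i n. has_period_on w i n 1 \<Longrightarrow> n < B"
    and \<theta>: "\<theta> = (1 - \<rho>) / (2 * real B)"
  shows "ACE W \<le> ereal (real K + 1 - \<theta>)"
proof -
  have bp: "bounded_periods w" by (rule bounded_periods_if_ACE_finite) (simp add: ACE)
  have B: "1 \<le> B" using gap[of 0 0] by (simp add: has_period_on_def)
  have \<theta>01: "0 < \<theta>" "\<theta> \<le> 1"
  proof -
    show "0 < \<theta>" using \<rho> B by (simp add: \<theta>)
    have "1 - \<rho> \<le> 2 * real B" using \<rho> B by linarith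
    then show "\<theta> \<le> 1" using B by (simp add: \<theta>)
  qed
  obtain m0 where m0: "\<And>m i k. m \<ge> m0 \<Longrightarrow> 1 \<le> k \<Longrightarrow> k \<le> m \<Longrightarrow> has_period_on w i m k \<Longrightarrow>
      real m \<le> (real K + \<rho>) * real k" using ACE_lessD[of w "real K + \<rho>"] ACE s by auto
  \<comment> \<open>For \<open>k \<ge> k0\<close> the rounding loss of 1 in \<open>d div B\<close>
    is below \<open>\<theta> * k\<close>, which explains the factor 2 in
    \<open>\<theta>\<close>.\<close>
  obtain k0 :: nat where k0: "1 / \<theta> < real k0" using reals_Archimedean2 by blast
  obtain K' where K': "\<And>i n q. 1 \<le> q \<Longrightarrow> q \<le> k0 \<Longrightarrow> has_period_on w i n q \<Longrightarrow> n < K'"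
    using bp unfolding bounded_periods_def by blast
  have e: "1 \<le> real K + 1 - \<theta>" using K \<theta>01 by linarith
  show ?thesis
  proof (rule ACE_image_le[OF bp e])
    fix \<epsilon> :: real assume \<epsilon>: "0 < \<epsilon>"
    have bound: "real (cut (i + m) - cut i) \<le> (real K + 1 - \<theta>) * real (cut (i + k) - cut i)"
      if m: "m0 + K' \<le> m" "1 \<le> k" "k \<le> m" "has_period_on w i m k" for i k m
    proof (cases "m div k < K")
      case True
      have "real (cut (i + m) - cut i) \<le> real K * real (cut (i + k) - cut i)"
        by (rule cut_diff_le_of_few_periods[OF m(4,2) True])
      also have "\<dots> \<le> (real K + 1 - \<theta>) * real (cut (i + k) - cut i)"
        using \<theta>01 by (intro mult_right_mono) auto
      finally show ?thesis .
    next
      case False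
      define r where "r = m - K * k"
      have "K * k \<le> m div k * k" using False by simp
      also have "\<dots> \<le> m" by (rule div_times_less_eq_dividend)
      finally have Kk: "m = K * k + r" by (simp add: r_def)
      have r: "real r \<le> \<rho> * real k" using m0[of m k i] m Kk by (simp add: algebra_simps)
      also have "\<dots> \<le> 1 * real k" using \<rho> by (intro mult_right_mono) auto
      finally have "r \<le> k" by simp
      \<comment> \<open>The part missing from the last period has at least
        \<open>(1 - \<rho>) * k\<close> letters; its image is what keeps the exponent below
        \<open>K + 1\<close>.\<close>
      define d where "d = k - r"
      have d: "k = r + d" using \<open>r \<le> k\<close> by (simp add: d_def)
      have "k0 \<le> k" using K'[OF m(2) _ m(4)] m(1) by (meson add_leD2 leD nat_le_linear)
      then have "1 / \<theta> < real k" using k0 by linarith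
      then have \<theta>k: "1 < \<theta> * real k" using \<theta>01(1) by (simp add: divide_less_eq mult.commute)
      have "(1 - \<rho>) * real k \<le> real d" using r d by (simp add: algebra_simps)
      then have "(1 - \<rho>) * real k / real B \<le> real d / real B" by (rule divide_right_mono) simp
      also have "(1 - \<rho>) * real k / real B = 2 * \<theta> * real k" using B by (simp add: \<theta> field_simps)
      also have "real d / real B \<le> real (d div B) + 1"
      proof -
        have "d \<le> (d div B + 1) * B" using dividend_less_div_times[of B d] B by simp
        then have "real d \<le> (real (d div B) + 1) * real B"
          by (metis of_nat_le_iff of_nat_mult of_nat_add of_nat_1)
        then show ?thesis using B by (simp add: divide_le_eq)
      qed
      finally have dB: "\<theta> * real k \<le> real (d div B)" using \<theta>k by linarith
      have "M * (d div B) \<le> cut (i + r + d) - cut (i + r)"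
        unfolding cut_diff_eq_sum M_def sum_distrib_right
        by (intro sum_mono mult_left_mono count_letter_ge_div gap) auto
      then have tail: "real M * real (d div B) \<le> real (cut (i + k)) - real (cut (i + r))"
        using cut_add_ge[of "i + r" d] unfolding d
        by (simp add: add.assoc flip: of_nat_mult of_nat_diff)
      have "real (cut (i + k) - cut i) \<le> real M * real k"
        using cut_add_le[of i k] by (simp flip: of_nat_mult)
      then have "\<theta> * real (cut (i + k) - cut i) \<le> real M * (\<theta> * real k)"
        using \<theta>01(1) by (simp add: mult.left_commute)
      also have "\<dots> \<le> real M * real (d div B)" using dB by (intro mult_left_mono) auto
      also note tail
      finally have "real (cut (i + r) - cut i) \<le> (1 - \<theta>) * real (cut (i + k) - cut i)"
        using cut_add_ge[of i r] cut_add_ge[of i k] by (simp add: algebra_simps of_nat_diff)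
      moreover have "cut (i + m) - cut i = K * (cut (i + k) - cut i) + (cut (i + r) - cut i)"
        using cut_period_div[OF m(4), of K r] Kk by simp
      ultimately show ?thesis by (simp add: distrib_right left_diff_distrib)
    qed
    show "\<exists>m0. \<forall>i k m. m0 \<le> m \<longrightarrow> 1 \<le> k \<longrightarrow> k \<le> m \<longrightarrow> has_period_on w i m k \<longrightarrow>
        real (cut (i + m) - cut i) \<le> (real K + 1 - \<theta> + \<epsilon>) * real (cut (i + k) - cut i)"
    proof (intro exI[of _ "m0 + K'"] allI impI)
      fix i k m assume m: "m0 + K' \<le> m" "1 \<le> k" "k \<le> m" "has_period_on w i m k"
      have "real (cut (i + m) - cut i) \<le> (real K + 1 - \<theta>) * real (cut (i + k) - cut i)"
        by (rule bound[OF m])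
      also have "\<dots> \<le> (real K + 1 - \<theta> + \<epsilon>) * real (cut (i + k) - cut i)"
        using \<epsilon> by (intro mult_right_mono) auto
      finally show "real (cut (i + m) - cut i) \<le> (real K + 1 - \<theta> + \<epsilon>) * real (cut (i + k) - cut i)" .
    qed
  qed
qed

end

section \<open>Uniform frequencies, the lower bound and the conclusion\<close>

text \<open>The common value of liminf and limsup lies in [0,1], hence is a real number, and the
  extremal frequencies squeeze every long factor. A letter that does not occur has frequency
  0.\<close>

lemma uniform_freq_imp_freq:
  assumes "uniform_freq w"
  shows "\<exists>\<phi>. \<forall>\<eta>>0. \<exists>n0. \<forall>n\<ge>n0. \<forall>i.
    \<bar>real (count_letter a (map w [i..<i+n])) - \<phi> * real n\<bar> \<le> \<eta> * real n"
proof (cases "a \<in> range w")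
  case False
  then have "count_letter a (map w [i..<i+n]) = 0" for i n
    by (auto simp: count_letter_def filter_empty_conv)
  then show ?thesis by (intro exI[of _ 0]) auto
next
  case True
  define lo where "lo n = (INF f\<in>Fact n w. ereal (real (count_letter a f) / real n))" for n
  define hi where "hi n = (SUP f\<in>Fact n w. ereal (real (count_letter a f) / real n))" for n
  have eq: "liminf lo = limsup hi"
    using assms True unfolding uniform_freq_def lo_def hi_def by blast
  have mem: "map w [i..<i+n] \<in> Fact n w" for i n by (auto simp: Fact_def)
  have lo: "lo n \<le> ereal (real (count_letter a (map w [i..<i+n])) / real n)" for n i
    unfolding lo_def by (rule INF_lower[OF mem])
  have hi: "ereal (real (count_letter a (map w [i..<i+n])) / real n) \<le> hi n" for n i
    unfolding hi_def by (rule SUP_upper[OF mem])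
  have "0 \<le> lo n" for n
    unfolding lo_def by (rule INF_greatest) simp
  then have "0 \<le> liminf lo" by (intro Liminf_bounded) auto
  moreover have "hi n \<le> 1" for n
    unfolding hi_def
  proof (rule SUP_least)
    fix x assume "x \<in> Fact n w"
    then have "count_letter a x \<le> n" unfolding Fact_def count_letter_def
      by (auto intro: order.trans[OF length_filter_le])
    then show "ereal (real (count_letter a x) / real n) \<le> 1"
      by (cases "n = 0") (simp_all add: divide_le_eq_1)
  qed
  then have "limsup hi \<le> 1" by (intro Limsup_bounded) auto
  ultimately obtain \<phi> where \<phi>: "liminf lo = ereal \<phi>" using eq by (cases "limsup hi") auto
  show ?thesis
  proof (intro exI[of _ \<phi>] allI impI)
    fix \<eta> :: real assume \<eta>: "0 < \<eta>"
    have "limsup hi < ereal (\<phi> + \<eta>)" "ereal (\<phi> - \<eta>) < liminf lo" using \<phi> eq \<eta> by auto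
    then have "\<forall>\<^sub>F n in sequentially. hi n < ereal (\<phi> + \<eta>) \<and> ereal (\<phi> - \<eta>) < lo n"
      by (intro eventually_conj Limsup_lessD less_LiminfD)
    then obtain n0 where n0: "\<And>n. n \<ge> n0 \<Longrightarrow> hi n < ereal (\<phi> + \<eta>) \<and> ereal (\<phi> - \<eta>) < lo n"
      by (auto simp: eventually_sequentially)
    show "\<exists>n0. \<forall>n\<ge>n0. \<forall>i. \<bar>real (count_letter a (map w [i..<i+n])) - \<phi> * real n\<bar> \<le> \<eta> * real n"
    proof (intro exI[of _ "Suc n0"] allI impI)
      fix n i assume n: "Suc n0 \<le> n"
      define c where "c = real (count_letter a (map w [i..<i+n]))"
      have "ereal (c / real n) < ereal (\<phi> + \<eta>)" "ereal (\<phi> - \<eta>) < ereal (c / real n)"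
        unfolding c_def using n0[of n] n
        by (blast intro: le_less_trans[OF hi] less_le_trans[OF _ lo] Suc_leD)+
      then have "c < (\<phi> + \<eta>) * real n" "(\<phi> - \<eta>) * real n < c"
        using n by (auto simp: divide_less_eq less_divide_eq)
      then show "\<bar>real (count_letter a (map w [i..<i+n])) - \<phi> * real n\<bar> \<le> \<eta> * real n"
        unfolding c_def[symmetric] by (simp add: abs_le_iff algebra_simps)
    qed
  qed
qed

text \<open>An injective renaming of letters is an injective morphism, and it preserves the periods
  of all factors.\<close>

lemma ACE_le_ACE_I:
  fixes w :: "nat \<Rightarrow> 'a::finite" and Gamma :: "'b::finite itself"
  assumes "card (UNIV :: 'a set) \<le> card (UNIV :: 'b set)"
  shows "ACE w \<le> ACE_I Gamma w"
proof -
  obtain g :: "'a \<Rightarrow> 'b" where g: "inj g"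
    using card_le_inj[OF finite_UNIV finite_UNIV assms] by auto
  define h where "h a = [g a]" for a
  have morph_h: "morph h u = map g u" for u
    by (induction u) (auto simp: morph_def h_def)
  have "injective_morph h"
    using g by (simp add: injective_morph_def morph_h[abs_def])
  then have "ACE (morph_inf h w) \<le> ACE_I Gamma w"
    unfolding ACE_I_def by (intro SUP_upper) simp
  moreover have eq: "morph_inf h w = g \<circ> w"
    by (rule ext) (simp add: morph_inf_def morph_h del: upt_Suc)
  have "ACE w \<le> ACE (g \<circ> w)"
  proof (rule ccontr)
    assume "\<not> ?thesis"
    then obtain e where e: "ACE (g \<circ> w) < ereal e" "ereal e < ACE w"
      using ereal_dense2 by (meson not_le)
    have "1 < ereal e" using ACE_ge_1[of "g \<circ> w"] e(1) by (rule le_less_trans)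
    obtain n0 where "\<And>n i q. n \<ge> n0 \<Longrightarrow> 1 \<le> q \<Longrightarrow> q \<le> n \<Longrightarrow> has_period_on (g \<circ> w) i n q \<Longrightarrow>
        real n \<le> e * real q" using ACE_lessD[OF e(1)] by blast
    moreover have "has_period_on (g \<circ> w) i n q \<longleftrightarrow> has_period_on w i n q" for i n q
      using g by (simp add: has_period_on_def inj_eq)
    ultimately have "ACE w \<le> ereal e"
      using \<open>1 < ereal e\<close> by (intro ACE_leI[of e n0]) (auto simp: one_ereal_def)
    then show False using e(2) by simp
  qed
  ultimately show ?thesis using eq by simp
qed

theorem theorem30:
  fixes w :: "nat \<Rightarrow> 'a::finite"
    and Gamma :: "'b::finite itself"
  assumes "card (UNIV :: 'a set) = 2"
    and "card (UNIV :: 'b set) \<ge> 2"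
    and "ACE w \<noteq> \<infinity>" and "ACE w \<noteq> -\<infinity>"
  shows "((uniform_freq w \<or> (\<exists>k::nat. ACE w = ereal (real k)))
           \<longrightarrow> ACE_I Gamma w = ACE w) \<and>
         (\<not> (uniform_freq w \<or> (\<exists>k::nat. ACE w = ereal (real k)))
           \<longrightarrow> ACE_I Gamma w < ereal (real_of_int \<lceil>real_of_ereal (ACE w)\<rceil>))"
proof (intro conjI impI)
  obtain s where s: "ACE w = ereal s" using assms(3,4) by (cases "ACE w") auto
  have code: "two_letter_code f" if "injective_morph f" for f :: "'a \<Rightarrow> 'b list"
    using assms(1) that by unfold_locales
  {
    assume uniform_or_nat: "uniform_freq w \<or> (\<exists>k::nat. ACE w = ereal (real k))"
    have "ACE (morph_inf f w) \<le> ACE w" if f: "injective_morph f" for f :: "'a \<Rightarrow> 'b list"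
      using uniform_or_nat
    proof
      assume "uniform_freq w"
      then have "\<forall>a. \<exists>\<phi>. \<forall>\<eta>>0. \<exists>n0. \<forall>n\<ge>n0. \<forall>i.
          \<bar>real (count_letter a (map w [i..<i+n])) - \<phi> * real n\<bar> \<le> \<eta> * real n"
        by (intro allI uniform_freq_imp_freq)
      then obtain \<phi> where "\<forall>a. \<forall>\<eta>>0. \<exists>n0. \<forall>n\<ge>n0. \<forall>i.
          \<bar>real (count_letter a (map w [i..<i+n])) - \<phi> a * real n\<bar> \<le> \<eta> * real n"
        by (rule choice[THEN exE])
      then show ?thesis
        by (intro two_letter_code.ACE_image_le_of_freq[OF code[OF f] s, of \<phi>]) blast
    next
      assume "\<exists>k::nat. ACE w = ereal (real k)"
      then show ?thesis using two_letter_code.ACE_image_le_nat[OF code[OF f]] by blast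
    qed
    then have "ACE_I Gamma w \<le> ACE w" unfolding ACE_I_def by (intro SUP_least) simp
    moreover have "ACE w \<le> ACE_I Gamma w" by (rule ACE_le_ACE_I) (use assms in simp)
    ultimately show "ACE_I Gamma w = ACE w" by (rule order.antisym)
  next
    assume not_nat: "\<not> (uniform_freq w \<or> (\<exists>k::nat. ACE w = ereal (real k)))"
    define K where "K = nat \<lfloor>s\<rfloor>"
    have s1: "1 \<le> s" using ACE_ge_1[of w] s by (simp add: one_ereal_def)
    then have K: "1 \<le> K" "real K \<le> s" "s < real K + 1" "real K = of_int \<lfloor>s\<rfloor>"
      unfolding K_def by (auto simp: le_nat_iff)
    have "s \<noteq> real K" using not_nat s by auto
    then have ceil: "of_int \<lceil>s\<rceil> = real K + 1" using K by (simp add: ceiling_altdef)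
    \<comment> \<open>The midpoint between the fractional part of \<open>s\<close> and 1.\<close>
    define \<rho> where "\<rho> = (s - real K + 1) / 2"
    have \<rho>: "s < real K + \<rho>" "0 \<le> \<rho>" "\<rho> < 1" using K(2,3) by (auto simp: \<rho>_def field_simps)
    obtain B where B: "\<And>i n. has_period_on w i n 1 \<Longrightarrow> n < B"
      using bounded_periods_if_ACE_finite[OF assms(3)] unfolding bounded_periods_def
      by (metis order.refl)
    define \<theta> where "\<theta> = (1 - \<rho>) / (2 * real B)"
    have "0 < B" using B[of 0 0] by (simp add: has_period_on_def)
    then have "0 < \<theta>" using \<rho> by (simp add: \<theta>_def)
    \<comment> \<open>Since \<open>\<theta>\<close> was fixed before \<open>f\<close>, the supremum
      over all morphisms stays strictly below the ceiling.\<close>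
    have "ACE (morph_inf f w) \<le> ereal (real K + 1 - \<theta>)" if f: "injective_morph f" for f :: "'a \<Rightarrow> 'b list"
      by (rule two_letter_code.ACE_image_le_below_ceiling[OF code[OF f] s K(1) \<rho> B \<theta>_def])
    then have "ACE_I Gamma w \<le> ereal (real K + 1 - \<theta>)" unfolding ACE_I_def by (intro SUP_least) simp
    also have "\<dots> < ereal (real_of_int \<lceil>real_of_ereal (ACE w)\<rceil>)"
      using \<open>0 < \<theta>\<close> s ceil by simp
    finally show "ACE_I Gamma w < ereal (real_of_int \<lceil>real_of_ereal (ACE w)\<rceil>)" .
  }
qed

end
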